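(* For every positive integer $n$, let $\pi(n)$ denote the number of primes less than or equal to $n$. Then \[ \pi(n)=n-1-\sum_{i=2}^{\lfloor\sqrt{n}\rfloor}\left(\left\lfloor\frac{n}{i}\right\rfloor-i+1\right)+\sum_{s=2}^{\lfloor\sqrt{n}\rfloor}(-1)^{s}\sum_{1<i_1<i_2<\dots<i_s\leqslant\lfloor\sqrt{n}\rfloor}\left(\left\lfloor\frac{n}{\operatorname{LCM}(i_1,\dots,i_s)}\right\rfloor-\left\lfloor\frac{i_s^2-1}{\operatorname{LCM}(i_1,\dots,i_s)}\right\rfloor\right), \] where the inner sum runs over all strictly increasing $s$-tuples of integers $i_1<\dots<i_s$ with $1<i_1$ and $i_s\leqslant\lfloor\sqrt n\rfloor$.
   Context: $\lfloor x\rfloor$ denotes the floor of $x$, and $\operatorname{LCM}(i_1,\dots,i_s)$ denotes the least common multiple of the positive integers $i_1,\dots,i_s$. Empty sums are zero. *)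

theory Defs
  imports Complex_Main "HOL-Computational_Algebra.Primes"
begin

definition prime_pi :: "nat \<Rightarrow> nat" where
  "prime_pi n = card {p. prime p \<and> p \<le> n}"

(* The tuples 1 < i_1 < ... < i_s \<le> m, encoded as lists [i_1, ..., i_s]. *)
definition increasing_tuples :: "nat \<Rightarrow> nat \<Rightarrow> nat list set" where
  "increasing_tuples s m =
     {is. length is = s \<and> sorted_wrt (<) is \<and> (\<forall>i\<in>set is. 1 < i \<and> i \<le> m)}"

end

theory Submission imports Defs begin

text \<open>
  Every composite number \<open>x \<le> n\<close> has a divisor \<open>i > 1\<close> with \<open>i\<^sup>2 \<le> x\<close>, so the composites up to \<open>n\<close>
  are the union, over \<open>2 \<le> i \<le> \<lfloor>\<surd>n\<rfloor>\<close>, of the sets of multiples of \<open>i\<close> in \<open>[i\<^sup>2, n]\<close>. An intersection of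
  such sets over an index set \<open>I\<close> consists of the multiples of \<open>Lcm I\<close> in \<open>[(Max I)\<^sup>2, n]\<close>, and the
  formula is inclusion-exclusion with the terms grouped by \<open>card I\<close>.
\<close>

text \<open>Multiplication by \<open>d\<close> maps the quotients in
  \<open>{(a - 1) div d <.. n div d}\<close> bijectively onto the multiples. Since
  \<open>a \<le> Suc n\<close>, the difference of quotients is not truncated, so it survives the
  passage to \<open>int\<close>.\<close>

lemma card_multiples_Icc:
  fixes a d n :: nat
  assumes "d > 0" "a > 0" "a \<le> Suc n"
  shows "int (card {x \<in> {a..n}. d dvd x}) = int (n div d) - int ((a - 1) div d)"
proof -
  have "bij_betw ((*) d) {(a - 1) div d <.. n div d} {x \<in> {a..n}. d dvd x}"
  proof (rule bij_betw_imageI)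
    show "inj_on ((*) d) {(a - 1) div d <.. n div d}"
      using assms by (auto simp: inj_on_def)
    have mem: "k \<in> {(a - 1) div d <.. n div d} \<longleftrightarrow> d * k \<in> {a..n}" for k
    proof -
      have "(a - 1) div d < k \<longleftrightarrow> a - 1 < k * d"
        using assms by (simp add: div_less_iff_less_mult)
      moreover have "k \<le> n div d \<longleftrightarrow> k * d \<le> n"
        using assms by (simp add: less_eq_div_iff_mult_less_eq)
      ultimately show ?thesis
        using assms by (auto simp: mult.commute)
    qed
    show "(*) d ` {(a - 1) div d <.. n div d} = {x \<in> {a..n}. d dvd x}"
    proof (intro equalityI subsetI)
      fix x assume "x \<in> (*) d ` {(a - 1) div d <.. n div d}"
      then obtain k where "x = d * k" "k \<in> {(a - 1) div d <.. n div d}"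
        by blast
      then show "x \<in> {x \<in> {a..n}. d dvd x}"
        unfolding mem by simp
    next
      fix x assume "x \<in> {x \<in> {a..n}. d dvd x}"
      then obtain k where "x = d * k" "d * k \<in> {a..n}"
        by blast
      then show "x \<in> (*) d ` {(a - 1) div d <.. n div d}"
        unfolding mem[symmetric] by blast
    qed
  qed
  then have "card {x \<in> {a..n}. d dvd x} = n div d - (a - 1) div d"
    by (simp flip: bij_betw_same_card)
  moreover have "(a - 1) div d \<le> n div d"
    using assms by (intro div_le_mono) auto
  ultimately show ?thesis
    by simp
qed

text \<open>In a nontrivial factorization the smaller factor has square at most \<open>x\<close>.
  Conversely, \<open>i < i^2 \<le> x\<close> makes \<open>i\<close> a proper divisor.\<close>

lemma composite_iff_multiple_ge_square:
  fixes x :: nat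
  assumes "x > 1"
  shows "\<not> prime x \<longleftrightarrow> (\<exists>i\<ge>2. i dvd x \<and> i\<^sup>2 \<le> x)"
proof
  assume "\<not> prime x"
  then obtain a where a: "a dvd x" "a \<noteq> 1" "a \<noteq> x"
    using assms by (auto simp: prime_nat_iff)
  then obtain b where b: "x = a * b"
    by blast
  have "a \<noteq> 0" "b \<noteq> 0" "b \<noteq> 1"
    using assms a b by (auto intro!: Nat.gr0I)
  with a b have ab: "x = a * b" "a > 1" "b > 1"
    by linarith+
  show "\<exists>i\<ge>2. i dvd x \<and> i\<^sup>2 \<le> x"
  proof (cases "a \<le> b")
    case True
    then show ?thesis
      using ab by (intro exI[of _ a]) (auto simp: power2_eq_square)
  next
    case False
    then show ?thesis
      using ab by (intro exI[of _ b]) (auto simp: power2_eq_square)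
  qed
next
  assume "\<exists>i\<ge>2. i dvd x \<and> i\<^sup>2 \<le> x"
  then obtain i where i: "i \<ge> 2" "i dvd x" "i\<^sup>2 \<le> x"
    by blast
  have "i < i\<^sup>2"
    using i by (simp add: power2_eq_square)
  with i have "i < x"
    by simp
  then show "\<not> prime x"
    using i by (auto simp: prime_nat_iff)
qed

lemma le_floor_sqrt_iff: "i \<le> nat \<lfloor>sqrt (real n)\<rfloor> \<longleftrightarrow> i\<^sup>2 \<le> n"
proof -
  have "i \<le> nat \<lfloor>sqrt (real n)\<rfloor> \<longleftrightarrow> real i \<le> sqrt (real n)"
    by (simp add: le_nat_iff le_floor_iff)
  also have "\<dots> \<longleftrightarrow> (real i)\<^sup>2 \<le> real n"
    \<comment> \<open>Monotonicity of the square root, with \<open>real i\<close> rewritten as the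
      root of its own square.\<close>
    using real_sqrt_le_iff[of "(real i)\<^sup>2" "real n"] by (simp only: real_sqrt_abs abs_of_nat)
  also have "\<dots> \<longleftrightarrow> i\<^sup>2 \<le> n"
    by (metis of_nat_le_iff of_nat_power)
  finally show ?thesis .
qed

text \<open>Divisibility by all members is divisibility by their \<open>Lcm\<close>, and of the
  lower bounds \<open>i^2\<close> only the largest, \<open>(Max I)^2\<close>, is binding.\<close>

lemma card_INT_multiples_ge_square:
  fixes I :: "nat set"
  assumes "finite I" "I \<noteq> {}" "\<And>i. i \<in> I \<Longrightarrow> 0 < i \<and> i\<^sup>2 \<le> n"
  shows "int (card (\<Inter>i\<in>I. {x \<in> {i\<^sup>2..n}. i dvd x})) =
    int (n div Lcm I) - int (((Max I)\<^sup>2 - 1) div Lcm I)"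
proof -
  have M: "Max I \<in> I"
    using assms by simp
  have "(\<Inter>i\<in>I. {x \<in> {i\<^sup>2..n}. i dvd x}) = {x \<in> {(Max I)\<^sup>2..n}. Lcm I dvd x}"
  proof (intro equalityI subsetI)
    fix x assume "x \<in> (\<Inter>i\<in>I. {x \<in> {i\<^sup>2..n}. i dvd x})"
    then show "x \<in> {x \<in> {(Max I)\<^sup>2..n}. Lcm I dvd x}"
      using M by (auto intro: Lcm_least)
  next
    fix x assume x: "x \<in> {x \<in> {(Max I)\<^sup>2..n}. Lcm I dvd x}"
    have "i\<^sup>2 \<le> x" "i dvd x" if "i \<in> I" for i
    proof -
      have "i\<^sup>2 \<le> (Max I)\<^sup>2"
        using that assms by (intro power_mono) auto
      also have "\<dots> \<le> x"
        using x by simp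
      finally show "i\<^sup>2 \<le> x" .
      show "i dvd x"
        using that x by (auto intro: dvd_trans[OF dvd_Lcm])
    qed
    with x show "x \<in> (\<Inter>i\<in>I. {x \<in> {i\<^sup>2..n}. i dvd x})"
      by auto
  qed
  moreover have "Lcm I > 0"
    using assms by (metis Lcm_0_iff gr0I less_irrefl)
  ultimately show ?thesis
    using card_multiples_Icc[of "Lcm I" "(Max I)\<^sup>2" n] assms(3)[OF M] by simp
qed

text \<open>A strictly increasing list is determined by its set of entries. This turns the tuples of
  the formula into the index sets of inclusion-exclusion.\<close>

lemma sum_increasing_tuples:
  "(\<Sum>is\<in>increasing_tuples s m. f is) =
   (\<Sum>I | I \<subseteq> {2..m} \<and> card I = s. f (sorted_list_of_set I))"
proof (rule sum.reindex_bij_witness[of _ sorted_list_of_set set])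
  fix "is" assume "is \<in> increasing_tuples s m"
  then have "is": "length is = s" "sorted_wrt (<) is" "\<forall>i\<in>set is. 1 < i \<and> i \<le> m"
    by (auto simp: increasing_tuples_def)
  then have distinct: "sorted is" "distinct is"
    by (auto simp: strict_sorted_iff)
  then show "sorted_list_of_set (set is) = is"
    by (simp add: sorted_list_of_set.idem_if_sorted_distinct)
  then show "f (sorted_list_of_set (set is)) = f is"
    by simp
  show "set is \<in> {I. I \<subseteq> {2..m} \<and> card I = s}"
    using "is" distinct by (auto simp: distinct_card Suc_leI)
next
  fix I assume I: "I \<in> {I. I \<subseteq> {2..m} \<and> card I = s}"
  then have "finite I"
    using finite_subset by blast
  then show "set (sorted_list_of_set I) = I"
    by simp
  show "sorted_list_of_set I \<in> increasing_tuples s m"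
    using I \<open>finite I\<close> by (auto simp: increasing_tuples_def)
qed

text \<open>Matches \<open>i_s\<close> in the formula with the \<open>Max I\<close> of the
  intersection count.\<close>

lemma last_sorted_list_of_set:
  fixes I :: "'a::linorder set"
  assumes "finite I" "I \<noteq> {}"
  shows "last (sorted_list_of_set I) = Max I"
proof -
  have "xs \<noteq> [] \<Longrightarrow> sorted xs \<Longrightarrow> Max (set xs) = last xs" for xs :: "'a list"
    by (induction xs) (auto simp: max_def)
  from this[of "sorted_list_of_set I"] show ?thesis
    using assms by simp
qed

text \<open>For \<open>l > 0\<close> the natural subtraction is not truncated, so it agrees with the
  real one.\<close>

lemma floor_square_minus_one_divide:
  assumes "l > 0"
  shows "\<lfloor>((real l)\<^sup>2 - 1) / real d\<rfloor> = int ((l\<^sup>2 - 1) div d)"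
proof -
  have "(real l)\<^sup>2 - 1 = real (l\<^sup>2 - 1)"
    using assms by simp
  then show ?thesis
    by (metis floor_divide_of_nat_eq)
qed

theorem mainTheorem1:
  fixes n :: nat
  assumes "n \<ge> 1"
  shows "int (prime_pi n) =
      int n - 1
      - (\<Sum>i = 2..nat \<lfloor>sqrt (real n)\<rfloor>. \<lfloor>real n / real i\<rfloor> - int i + 1)
      + (\<Sum>s = 2..nat \<lfloor>sqrt (real n)\<rfloor>. (-1) ^ s *
          (\<Sum>is \<in> increasing_tuples s (nat \<lfloor>sqrt (real n)\<rfloor>).
             \<lfloor>real n / real (Lcm (set is))\<rfloor>
             - \<lfloor>((real (last is))\<^sup>2 - 1) / real (Lcm (set is))\<rfloor>))"
proof -
  define m where "m = nat \<lfloor>sqrt (real n)\<rfloor>"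
  have m: "i \<le> m \<longleftrightarrow> i\<^sup>2 \<le> n" for i
    by (simp add: m_def le_floor_sqrt_iff)
  have "m \<ge> 1"
    using assms by (simp add: m)
  define A where "A i = {x \<in> {i\<^sup>2..n}. i dvd x}" for i :: nat
  \<comment> \<open>For \<open>I \<in> \<I>\<close>, \<open>c I\<close> is the size of the
    intersection of the \<open>A i\<close>; \<open>S s\<close> collects the index sets belonging to
    the summand \<open>s\<close> of the formula.\<close>
  define c where "c I = int (n div Lcm I) - int (((Max I)\<^sup>2 - 1) div Lcm I)" for I :: "nat set"
  define \<I> where "\<I> = {I. I \<subseteq> {2..m} \<and> I \<noteq> {}}"
  define S where "S s = {I. I \<subseteq> {2..m} \<and> card I = s}" for s
  have fin: "finite I" if "I \<subseteq> {2..m}" for I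
    using that finite_subset by blast

  have UN: "(\<Union>i\<in>{2..m}. A i) = {x \<in> {2..n}. \<not> prime x}"
  proof (intro set_eqI iffI)
    fix x assume "x \<in> (\<Union>i\<in>{2..m}. A i)"
    then obtain i where i: "2 \<le> i" "i dvd x" "i\<^sup>2 \<le> x" "x \<le> n"
      by (auto simp: A_def)
    \<comment> \<open>Rules out \<open>x = 0\<close> and \<open>x = 1\<close>, to which the
      criterion for composites does not apply.\<close>
    have "2 \<le> i\<^sup>2"
      using power_mono[OF i(1), of 2] by simp
    with i have "x > 1"
      by linarith
    with i show "x \<in> {x \<in> {2..n}. \<not> prime x}"
      using composite_iff_multiple_ge_square[of x] by auto
  next
    fix x assume x: "x \<in> {x \<in> {2..n}. \<not> prime x}"
    then obtain i where "2 \<le> i" "i dvd x" "i\<^sup>2 \<le> x"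
      using composite_iff_multiple_ge_square[of x] by auto
    with x show "x \<in> (\<Union>i\<in>{2..m}. A i)"
      by (auto simp: A_def m)
  qed

  \<comment> \<open>Primes and composites partition \<open>{2..n}\<close>, which has
    \<open>n - 1\<close> elements.\<close>
  have "{2..n} = {p. prime p \<and> p \<le> n} \<union> (\<Union>i\<in>{2..m}. A i)"
    by (auto simp: UN prime_ge_2_nat)
  moreover have "card ({p. prime p \<and> p \<le> n} \<union> (\<Union>i\<in>{2..m}. A i)) =
      prime_pi n + card (\<Union>i\<in>{2..m}. A i)"
    unfolding prime_pi_def by (rule card_Un_disjoint) (auto simp: UN)
  ultimately have "card {2..n} = prime_pi n + card (\<Union>i\<in>{2..m}. A i)"
    by simp
  then have pi: "int (prime_pi n) = int n - 1 - int (card (\<Union>i\<in>{2..m}. A i))"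
    using assms by simp

  \<comment> \<open>Cardinality is additive on disjoint finite sets, which is all that abstract
    inclusion-exclusion asks for.\<close>
  interpret Incl_Excl finite "int \<circ> card"
    by standard (auto simp: card_Un_disjnt)
  have "int (card (\<Union>i\<in>{2..m}. A i)) = (\<Sum>I\<in>\<I>. (- 1) ^ (card I + 1) * int (card (\<Inter>i\<in>I. A i)))"
    using restricted_indexed[of "{2..m}" A] by (simp add: A_def \<I>_def)
  also have "\<dots> = (\<Sum>I\<in>\<I>. (- 1) ^ (card I + 1) * c I)"
  proof (intro sum.cong refl arg_cong2[where f = "(*)"])
    fix I assume "I \<in> \<I>"
    then show "int (card (\<Inter>i\<in>I. A i)) = c I"
      unfolding A_def c_def \<I>_def using fin
      by (intro card_INT_multiples_ge_square) (auto simp: subset_iff simp flip: m)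
  qed
  \<comment> \<open>Since \<open>{2..m}\<close> has \<open>m - 1\<close> elements, the level
    \<open>s = m\<close> is empty and contributes 0; it is kept to match the range in the
    formula.\<close>
  also have "\<dots> = (\<Sum>s = 1..m. \<Sum>I | I \<in> \<I> \<and> card I = s. (- 1) ^ (card I + 1) * c I)"
  proof (rule sum.group [symmetric])
    show "finite \<I>"
      by (simp add: \<I>_def)
    have "card I \<le> m" "card I \<ge> 1" if "I \<in> \<I>" for I
      using that card_mono[of "{2..m}" I] fin[of I]
      by (auto simp: \<I>_def Suc_le_eq card_gt_0_iff)
    then show "card ` \<I> \<subseteq> {1..m}"
      by auto
  qed simp
  also have "\<dots> = (\<Sum>s = 1..m. (- 1) ^ (s + 1) * (\<Sum>I\<in>S s. c I))"
  proof (intro sum.cong refl)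
    fix s assume "s \<in> {1..m}"
    \<comment> \<open>Here \<open>s \<ge> 1\<close> already excludes the empty set.\<close>
    then have "{I. I \<in> \<I> \<and> card I = s} = S s"
      by (auto simp: \<I>_def S_def)
    then show "(\<Sum>I | I \<in> \<I> \<and> card I = s. (- 1) ^ (card I + 1) * c I) =
        (- 1) ^ (s + 1) * (\<Sum>I\<in>S s. c I)"
      by (auto simp: sum_distrib_left S_def intro!: sum.cong)
  qed
  \<comment> \<open>The term \<open>s = 1\<close> has sign \<open>+1\<close> and is split off;
    pulling one factor \<open>-1\<close> out of the others leaves \<open>(-1) ^ s\<close>.\<close>
  also have "\<dots> = (\<Sum>I\<in>S 1. c I) - (\<Sum>s = 2..m. (- 1) ^ s * (\<Sum>I\<in>S s. c I))"
    using \<open>m \<ge> 1\<close> by (simp add: sum.atLeast_Suc_atMost[of "Suc 0" m] sum_negf numeral_2_eq_2)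
  finally have ie: "int (card (\<Union>i\<in>{2..m}. A i)) =
      (\<Sum>I\<in>S 1. c I) - (\<Sum>s = 2..m. (- 1) ^ s * (\<Sum>I\<in>S s. c I))" .

  have "(\<Sum>I\<in>S 1. c I) = (\<Sum>i\<in>{2..m}. c {i})"
  proof -
    have "S 1 = (\<lambda>i. {i}) ` {2..m}"
      by (auto simp: S_def card_1_singleton_iff)
    then show ?thesis
      by (simp add: sum.reindex)
  qed
  also have "\<dots> = (\<Sum>i = 2..m. \<lfloor>real n / real i\<rfloor> - int i + 1)"
  proof (intro sum.cong refl)
    fix i assume "i \<in> {2..m}"
    then have "i \<ge> 2"
      by simp
    \<comment> \<open>Because \<open>i^2 - 1 = (i - 1) * i + (i - 1)\<close>; this is the source of
      \<open>- i + 1\<close> in the first sum.\<close>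
    then have "(i\<^sup>2 - 1) div i = i - 1"
      by (intro div_nat_eqI) (cases i; simp add: power2_eq_square)+
    then show "c {i} = \<lfloor>real n / real i\<rfloor> - int i + 1"
      using \<open>i \<ge> 2\<close> by (simp add: c_def floor_divide_of_nat_eq)
  qed
  finally have one: "(\<Sum>I\<in>S 1. c I) = (\<Sum>i = 2..m. \<lfloor>real n / real i\<rfloor> - int i + 1)" .

  have "(\<Sum>I\<in>S s. c I) = (\<Sum>is \<in> increasing_tuples s m.
      \<lfloor>real n / real (Lcm (set is))\<rfloor> - \<lfloor>((real (last is))\<^sup>2 - 1) / real (Lcm (set is))\<rfloor>)"
    if "s \<in> {2..m}" for s
    unfolding sum_increasing_tuples S_def
  proof (intro sum.cong refl)
    fix I assume "I \<in> {I. I \<subseteq> {2..m} \<and> card I = s}"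
    \<comment> \<open>From \<open>s \<ge> 2\<close> the set is nonempty, so \<open>Max I\<close> and
      the last list entry are meaningful and equal.\<close>
    then have I: "finite I" "I \<noteq> {}" "I \<subseteq> {2..m}"
      using that fin by auto
    then have "Max I > 0"
      using Max_in[of I] by fastforce
    with I show "c I = \<lfloor>real n / real (Lcm (set (sorted_list_of_set I)))\<rfloor> -
        \<lfloor>((real (last (sorted_list_of_set I)))\<^sup>2 - 1) / real (Lcm (set (sorted_list_of_set I)))\<rfloor>"
      by (simp add: c_def last_sorted_list_of_set floor_square_minus_one_divide floor_divide_of_nat_eq)
  qed
  then show ?thesis
    unfolding pi ie one m_def[symmetric] by simp
qed

end
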